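(* Let $\varphi:\mathbf{ST}_+\to\mathcal MMR_+$ be the linear map with $\varphi(1)=1$ and $\varphi(f)=\mathrm{std}_{\mathcal M}[f^{-1}(1),\dots,f^{-1}(r)]$ for $f\in\mathbf{ST}_n^r$. Then $\varphi$ is surjective onto the basis of $\mathcal M$-permutations, and for all $f\in\mathbf{ST}_n$, $g\in\mathbf{ST}_m$: (1) $\varphi(f\prec_qg)=\varphi(f)\prec_q\varphi(g)$; (2) $\varphi(f\cdot_qg)=\varphi(f)\cdot_q\varphi(g)$; (3) $\varphi(f\succ_qg)=\varphi(f)\succ_q\varphi(g)$; (4) $\Delta(\varphi(f))=(\varphi\otimes\varphi)(\Delta(f))$.
   Context: Words: maps $h:[n]\to\mathbb{Z}_{>0}$ identified with $(h(1),\dots,h(n))$; $\max(h)$ largest value; $hk$ concatenation; $\cap(h,k)=|\mathrm{Im}(h)\cap\mathrm{Im}(k)|$; $h$ surjective if $\mathrm{Im}(h)=[\max(h)]$; $\mathrm{std}(h)$ the unique surjective word $s$ with $h(i)<h(j)\iff s(i)<s(j)$. $\mathbf{ST}(q)$: $\mathbf{ST}_n^r$ the surjections $[n]\to[r]$, $\mathbf{ST}_n=\bigcup_r\mathbf{ST}_n^r$, $\mathbf{ST}=\bigoplus_{n\ge1}\mathbb{K}[\mathbf{ST}_n]$, $\mathbf{ST}_+=\mathbf{ST}\oplus\mathbb{K}1$. $f\succ_qg=\sum_{\max(h)<\max(k)}q^{\cap(h,k)}hk$, $f\cdot_qg=\sum_{\max(h)=\max(k)}q^{\cap(h,k)-1}hk$,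 $f\prec_qg=\sum_{\max(h)>\max(k)}q^{\cap(h,k)}hk$, over pairs of words $(h,k)$ with $hk$ surjective, $\mathrm{std}(h)=f$, $\mathrm{std}(k)=g$. Coproduct: $\Delta(1)=1\otimes1$; for $f\in\mathbf{ST}_n^r$, $\Delta(f)=\sum_{j=0}^rf|^{[j]}\otimes\mathrm{std}(f|^{\{j+1,\dots,r\}})$, with $f|^K=(f(j_1),\dots,f(j_l))$, $\{j_1<\dots<j_l\}=f^{-1}(K)$, empty word $=1$. $\mathcal MMR(q)$: an $\mathcal M$-permutation of $n$ is an ordered sequence $(B_1,\dots,B_m)$ of nonempty pairwise disjoint subsets with union $[n]$ such that no $i,i+1$ lie in the same block; $S^{\mathcal M}_n$ their set, $\mathcal MMR=\bigoplus_{n\ge1}\mathbb{K}[S^{\mathcal M}_n]$, $\mathcal MMR_+=\mathcal MMR\oplus\mathbb{K}1$. Restriction $W|_J=(W_1\cap J,\dots,W_l\cap J)$ with empty blocks deleted. $\mathrm{std}_{\mathcal M}$ of a sequence $C=(C_1,\dots,C_p)$ of nonempty disjoint finite subsets of $\mathbb{Z}_{>0}$ (empty sets in the input are first deleted): with $s_1<\dots<s_k$ the elements of $\bigcup C_c$ and $w(t)=c$ iff $s_t\in C_c$, delete from $w$ each letter equal to its predecessor to get $w'$ of length $l$, and set $\mathrm{std}_{\mathcal M}(C)=(w'^{-1}(1),\dots,w'^{-1}(p))\in S^{\mathcal M}_l$; $\mathrm{std}_{\mathcal M}$ of the empty sequence is $1$. Products for $B\in S^{\mathcal M}_n$, $D\in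 S^{\mathcal M}_m$: let $\mathcal W(B,D)$ be the pairs $(W,S)$ with either $W\in S^{\mathcal M}_{n+m}$, $S=\{n+1,\dots,n+m\}$, or $W\in S^{\mathcal M}_{n+m-1}$, $S=\{n,\dots,n+m-1\}$, and $W|_{[n]}=B$, $\mathrm{std}_{\mathcal M}(W|_S)=D$; for $W=(W_1,\dots,W_l)$ let $\cap^W_{B,D}=\#\{j:W_j\cap[n]\ne\emptyset\ne W_j\cap S\}$. $B\succ_qD=\sum_{W_l\cap[n]=\emptyset}q^{\cap^W_{B,D}}W$, $B\cdot_qD=\sum_{W_l\cap[n]\ne\emptyset\ne W_l\cap S}q^{\cap^W_{B,D}-1}W$, $B\prec_qD=\sum_{W_l\cap S=\emptyset}q^{\cap^W_{B,D}}W$, sums over $\mathcal W(B,D)$. Coproduct: $\Delta(1)=1\otimes1$ and for $B=(B_1,\dots,B_l)$, $\Delta(B)=\sum_{i=0}^l\mathrm{std}_{\mathcal M}(B_1,\dots,B_i)\otimes\mathrm{std}_{\mathcal M}(B_{i+1},\dots,B_l)$. *)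

theory Defs
  imports Main "HOL-Library.Function_Algebras"
begin

text \<open>An element of K[X] is represented by its coefficient function X => K.
  The basis vector of x is vec x.\<close>

definition vec :: "'b \<Rightarrow> ('b \<Rightarrow> 'a::field)" where
  "vec x = (\<lambda>y. if y = x then 1 else 0)"

definition lin :: "('b \<Rightarrow> 'c) \<Rightarrow> ('b \<Rightarrow> 'a::field) \<Rightarrow> ('c \<Rightarrow> 'a)" where
  "lin phi c = (\<lambda>y. \<Sum>x\<in>{x. c x \<noteq> 0 \<and> phi x = y}. c x)"

text \<open>Words are lists of positive naturals; the empty word is the unit 1.\<close>

definition wmax :: "nat list \<Rightarrow> nat" where
  "wmax h = Max (insert 0 (set h))"

definition surj_word :: "nat list \<Rightarrow> bool" where
  "surj_word h \<longleftrightarrow> set h = {1..wmax h}"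

definition ST :: "nat \<Rightarrow> nat \<Rightarrow> nat list set" where
  "ST n r = {f. length f = n \<and> surj_word f \<and> wmax f = r}"

definition STn :: "nat \<Rightarrow> nat list set" where
  "STn n = {f. length f = n \<and> surj_word f}"

definition std :: "nat list \<Rightarrow> nat list" where
  "std h = (THE s. surj_word s \<and> length s = length h \<and>
     (\<forall>i<length h. \<forall>j<length h. h!i < h!j \<longleftrightarrow> s!i < s!j))"

definition cap :: "nat list \<Rightarrow> nat list \<Rightarrow> nat" where
  "cap h k = card (set h \<inter> set k)"

definition st_prod :: "(nat \<Rightarrow> nat \<Rightarrow> bool) \<Rightarrow> (nat \<Rightarrow> nat) \<Rightarrow> 'a::field \<Rightarrow>
    nat list \<Rightarrow> nat list \<Rightarrow> (nat list \<Rightarrow> 'a)" where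
  "st_prod R E q f g = (\<lambda>w. \<Sum>(h,k)\<in>{(h,k). w = h @ k \<and> surj_word (h @ k) \<and>
       std h = f \<and> std k = g \<and> R (wmax h) (wmax k)}. q ^ E (cap h k))"

definition st_succ :: "'a::field \<Rightarrow> nat list \<Rightarrow> nat list \<Rightarrow> (nat list \<Rightarrow> 'a)" where
  "st_succ q f g = st_prod (\<lambda>a b. a < b) (\<lambda>c. c) q f g"

definition st_dot :: "'a::field \<Rightarrow> nat list \<Rightarrow> nat list \<Rightarrow> (nat list \<Rightarrow> 'a)" where
  "st_dot q f g = st_prod (\<lambda>a b. a = b) (\<lambda>c. c - 1) q f g"

definition st_prec :: "'a::field \<Rightarrow> nat list \<Rightarrow> nat list \<Rightarrow> (nat list \<Rightarrow> 'a)" where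
  "st_prec q f g = st_prod (\<lambda>a b. a > b) (\<lambda>c. c) q f g"

definition wrestr :: "nat list \<Rightarrow> nat set \<Rightarrow> nat list" where
  "wrestr f K = filter (\<lambda>x. x \<in> K) f"

definition st_coprod :: "nat list \<Rightarrow> (nat list \<times> nat list \<Rightarrow> 'a::field)" where
  "st_coprod f = (\<Sum>j\<in>{0..wmax f}. vec (wrestr f {1..j}, std (wrestr f {j+1..wmax f})))"

text \<open>An M-permutation is a list of sets of naturals; the empty list is the unit 1.\<close>

definition mperm :: "nat \<Rightarrow> nat set list \<Rightarrow> bool" where
  "mperm n B \<longleftrightarrow> (\<forall>b\<in>set B. b \<noteq> {}) \<and>
     (\<forall>i<length B. \<forall>j<length B. i \<noteq> j \<longrightarrow> B!i \<inter> B!j = {}) \<and>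
     \<Union>(set B) = {1..n} \<and>
     (\<forall>b\<in>set B. \<forall>i. \<not> (i \<in> b \<and> i + 1 \<in> b))"

definition msize :: "nat set list \<Rightarrow> nat" where
  "msize B = card (\<Union>(set B))"

definition mrestr :: "nat set list \<Rightarrow> nat set \<Rightarrow> nat set list" where
  "mrestr W J = filter (\<lambda>b. b \<noteq> {}) (map (\<lambda>b. b \<inter> J) W)"

text \<open>std_M: blocks indexed from 0 internally; positions t in 1..l.\<close>
definition stdM :: "nat set list \<Rightarrow> nat set list" where
  "stdM C = (let C' = filter (\<lambda>b. b \<noteq> {}) C;
                 S = sorted_list_of_set (\<Union>(set C'));
                 w = map (\<lambda>s. THE c. c < length C' \<and> s \<in> C'!c) S;
                 w' = remdups_adj w
             in map (\<lambda>c. {t\<in>{1..length w'}. w'!(t-1) = c}) [0..<length C'])"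

definition capW :: "nat set list \<Rightarrow> nat \<Rightarrow> nat set \<Rightarrow> nat" where
  "capW W n S = card {j. j < length W \<and> W!j \<inter> {1..n} \<noteq> {} \<and> W!j \<inter> S \<noteq> {}}"

definition mmr_prod :: "(nat set \<Rightarrow> nat set \<Rightarrow> nat set \<Rightarrow> bool) \<Rightarrow> (nat \<Rightarrow> nat) \<Rightarrow> 'a::field \<Rightarrow>
    nat set list \<Rightarrow> nat set list \<Rightarrow> (nat set list \<Rightarrow> 'a)" where
  "mmr_prod P E q B D = (\<lambda>W. let n = msize B; m = msize D in
     \<Sum>S\<in>{S. ((mperm (n + m) W \<and> S = {n+1..n+m}) \<or> (mperm (n + m - 1) W \<and> S = {n..n+m-1}))
              \<and> mrestr W {1..n} = B \<and> stdM (mrestr W S) = D \<and> P (last W) {1..n} S}.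
       q ^ E (capW W n S))"

definition mmr_succ :: "'a::field \<Rightarrow> nat set list \<Rightarrow> nat set list \<Rightarrow> (nat set list \<Rightarrow> 'a)" where
  "mmr_succ q B D = mmr_prod (\<lambda>L N S. L \<inter> N = {}) (\<lambda>c. c) q B D"

definition mmr_dot :: "'a::field \<Rightarrow> nat set list \<Rightarrow> nat set list \<Rightarrow> (nat set list \<Rightarrow> 'a)" where
  "mmr_dot q B D = mmr_prod (\<lambda>L N S. L \<inter> N \<noteq> {} \<and> L \<inter> S \<noteq> {}) (\<lambda>c. c - 1) q B D"

definition mmr_prec :: "'a::field \<Rightarrow> nat set list \<Rightarrow> nat set list \<Rightarrow> (nat set list \<Rightarrow> 'a)" where
  "mmr_prec q B D = mmr_prod (\<lambda>L N S. L \<inter> S = {}) (\<lambda>c. c) q B D"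

definition mmr_coprod :: "nat set list \<Rightarrow> (nat set list \<times> nat set list \<Rightarrow> 'a::field)" where
  "mmr_coprod B = (\<Sum>i\<in>{0..length B}. vec (stdM (take i B), stdM (drop i B)))"

definition phi :: "nat list \<Rightarrow> nat set list" where
  "phi f = stdM (map (\<lambda>c. {i\<in>{1..length f}. f!(i-1) = c}) [1..<wmax f + 1])"

end

theory Submission
  imports Defs
begin

text \<open>The map sending a word to the sets of positions of its letters, listed in increasing order of the
  letters, identifies words up to standardization with set compositions; \<open>M\<close>-permutations correspond
  to the words without equal neighbours. Under this identification \<open>std\<^sub>M\<close> and hence \<open>phi\<close> become
  \<open>remdups_adj\<close>, the contraction of constant runs. A word \<open>h\<close> is determined by \<open>std h\<close> together with its
  contraction, so a pair \<open>(h, k)\<close> contributing to a product of \<open>f\<close> and \<open>g\<close> is determined by the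
  contraction of \<open>hk\<close>. The two kinds of terms in the product of \<open>M\<close>-permutations record whether the
  last run of \<open>h\<close> merges with the first run of \<open>k\<close>. Since runs carry the same set of letters as the
  word, intersections and maxima agree term by term. For the coproduct it suffices that contraction
  is compatible with restriction to a set of letters.\<close>

section \<open>Ranks and standardization of words\<close>

text \<open>The comparison is non-strict so that ranks in a finite set start at 1, as the letters of
  a surjective word do.\<close>

definition rank :: "nat set \<Rightarrow> nat \<Rightarrow> nat" where
  "rank A x = card {y \<in> A. y \<le> x}"

lemma strict_mono_on_rank: "finite A \<Longrightarrow> strict_mono_on A (rank A)"
proof (rule strict_mono_onI)
  fix x y assume "finite A" "x \<in> A" "y \<in> A" "x < y"
  then have "{z \<in> A. z \<le> x} \<subseteq> {z \<in> A. z \<le> y}" "y \<in> {z \<in> A. z \<le> y} - {z \<in> A. z \<le> x}"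
    by auto
  then show "rank A x < rank A y"
    unfolding rank_def using \<open>finite A\<close> by (intro psubset_card_mono) auto
qed

text \<open>This is the source of both the uniqueness of the standardization and its invariance
  under increasing relabelling.\<close>

lemma rank_image:
  assumes "strict_mono_on A g" "x \<in> A"
  shows "rank (g ` A) (g x) = rank A x"
proof -
  have "{y \<in> g ` A. y \<le> g x} = g ` {y \<in> A. y \<le> x}"
    using strict_mono_on_less_eq[OF assms(1) _ assms(2)] by auto
  moreover have "inj_on g {y \<in> A. y \<le> x}"
    by (rule inj_on_subset[OF strict_mono_on_imp_inj_on[OF assms(1)]]) auto
  ultimately show ?thesis
    by (simp add: rank_def card_image)
qed

lemma wmax_eqI: "set h = set k \<Longrightarrow> wmax h = wmax k"
  by (simp add: wmax_def)

lemma surj_word_eqI: "set h = set k \<Longrightarrow> surj_word h \<longleftrightarrow> surj_word k"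
  by (simp add: surj_word_def wmax_def)

lemma surj_wordI:
  assumes "set h = {1..r}"
  shows "surj_word h" "wmax h = r"
proof -
  have "insert 0 {1..r} = {0..r}" by auto
  then show "wmax h = r" using assms by (auto simp: wmax_def intro: Max_eqI)
  then show "surj_word h" using assms by (simp add: surj_word_def)
qed

lemma rank_surj_word:
  assumes "surj_word s" "x \<in> set s"
  shows "rank (set s) x = x"
proof -
  have "{y \<in> set s. y \<le> x} = {1..x}"
    using assms unfolding surj_word_def by auto
  then show ?thesis by (simp add: rank_def)
qed

lemma rank_image_self:
  assumes "finite A"
  shows "rank A ` A = {1..card A}"
proof (rule card_subset_eq)
  show "rank A ` A \<subseteq> {1..card A}"
  proof
    fix z assume "z \<in> rank A ` A"
    then obtain x where x: "x \<in> A" "z = rank A x" by auto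
    have "card {y \<in> A. y \<le> x} > 0" using x assms by (auto simp: card_gt_0_iff)
    moreover have "card {y \<in> A. y \<le> x} \<le> card A" using assms by (intro card_mono) auto
    ultimately show "z \<in> {1..card A}" using x by (simp add: rank_def)
  qed
  show "card (rank A ` A) = card {1..card A}"
    using strict_mono_on_imp_inj_on[OF strict_mono_on_rank[OF assms]] by (simp add: card_image)
qed simp

text \<open>The relabelling sends a letter of \<open>h\<close> to the entry of \<open>k\<close> at
  any position where that letter stands. The choice of position is immaterial: equal entries are
  those of which neither is smaller, and this is preserved.\<close>

lemma order_isomorphic_words_relabel:
  fixes h k :: "nat list"
  assumes len: "length k = length h"
    and iso: "\<forall>i<length h. \<forall>j<length h. h!i < h!j \<longleftrightarrow> k!i < k!j"
  obtains g where "strict_mono_on (set h) g" "k = map g h"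
proof -
  define p where "p x = (SOME i. i < length h \<and> h!i = x)" for x
  have p: "p x < length h \<and> h ! p x = x" if "x \<in> set h" for x
    using that unfolding p_def in_set_conv_nth by (rule someI_ex)
  define g where "g x = k ! p x" for x
  have "strict_mono_on (set h) g"
    using p iso unfolding g_def by (intro strict_mono_onI) metis
  moreover have "k = map g h"
  proof (rule nth_equalityI)
    fix i assume i: "i < length k"
    have q: "p (h!i) < length h" "h ! p (h!i) = h!i" using p i len by auto
    then have "\<not> k!i < k ! p (h!i)" "\<not> k ! p (h!i) < k!i" using iso i len by (metis less_irrefl)+
    then show "k!i = map g h ! i" using i len by (simp add: g_def)
  qed (simp add: len)
  ultimately show ?thesis using that by blast
qed

text \<open>A candidate for the definite description is an increasing relabelling of
  \<open>h\<close>, which preserves ranks, and in a surjective word every letter is its own rank. So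
  the candidate must replace each letter by its rank.\<close>

lemma std_eq_map_rank: "std h = map (rank (set h)) h"
  unfolding std_def
proof (rule the_equality)
  have "set (map (rank (set h)) h) = {1..card (set h)}"
    by (simp add: rank_image_self)
  then have "surj_word (map (rank (set h)) h)"
    by (rule surj_wordI)
  then show "surj_word (map (rank (set h)) h) \<and> length (map (rank (set h)) h) = length h \<and>
      (\<forall>i<length h. \<forall>j<length h. h!i < h!j \<longleftrightarrow> map (rank (set h)) h ! i < map (rank (set h)) h ! j)"
    using strict_mono_on_less[OF strict_mono_on_rank[of "set h"]] by simp
next
  fix s
  assume s: "surj_word s \<and> length s = length h \<and>
     (\<forall>i<length h. \<forall>j<length h. h!i < h!j \<longleftrightarrow> s!i < s!j)"
  then obtain g where g: "strict_mono_on (set h) g" "s = map g h"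
    using order_isomorphic_words_relabel[of s h] by blast
  have "g x = rank (set h) x" if "x \<in> set h" for x
    using rank_image[OF g(1) that] rank_surj_word[of s "g x"] s g that by auto
  then show "s = map (rank (set h)) h" using g by simp
qed

lemma surj_word_std: "surj_word (std h)"
proof -
  have "set (std h) = {1..card (set h)}"
    by (simp add: rank_image_self std_eq_map_rank)
  then show ?thesis by (rule surj_wordI)
qed

lemma length_std [simp]: "length (std h) = length h"
  by (simp add: std_eq_map_rank)

lemma std_surj_word: "surj_word s \<Longrightarrow> std s = s"
  by (simp add: std_eq_map_rank rank_surj_word map_idI)

lemma std_map: "strict_mono_on (set h) g \<Longrightarrow> std (map g h) = std h"
  by (simp add: std_eq_map_rank rank_image)

text \<open>Converse of \<open>std_map\<close>: both words are order isomorphic to their common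
  standardization, hence to each other.\<close>

lemma std_eq_relabel:
  assumes "std h = std k"
  obtains g where "strict_mono_on (set h) g" "k = map g h"
proof (rule order_isomorphic_words_relabel)
  show len: "length k = length h"
    using assms by (metis length_std)
  show "\<forall>i<length h. \<forall>j<length h. h!i < h!j \<longleftrightarrow> k!i < k!j"
  proof (intro allI impI)
    fix i j assume ij: "i < length h" "j < length h"
    have "h!i < h!j \<longleftrightarrow> std h ! i < std h ! j"
      using ij strict_mono_on_less[OF strict_mono_on_rank[of "set h"]] by (simp add: std_eq_map_rank)
    also have "\<dots> \<longleftrightarrow> k!i < k!j"
      using ij len strict_mono_on_less[OF strict_mono_on_rank[of "set k"]]
      unfolding assms by (simp add: std_eq_map_rank)
    finally show "h!i < h!j \<longleftrightarrow> k!i < k!j" .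
  qed
qed (rule that)

section \<open>Contraction of constant runs\<close>

lemma remdups_adj_map_inj_on:
  "inj_on f (set xs) \<Longrightarrow> remdups_adj (map f xs) = map f (remdups_adj xs)"
  by (induction xs rule: remdups_adj.induct) auto

text \<open>Deleting letters can create new equal neighbours, so an outer contraction is
  unavoidable; contracting beforehand only merges neighbours that are kept or deleted together. The
  coproduct uses this.\<close>

lemma remdups_adj_filter_remdups_adj:
  "remdups_adj (filter P (remdups_adj xs)) = remdups_adj (filter P xs)"
proof (induction xs rule: remdups_adj.induct)
  case (3 x y xs)
  show ?case
  proof (cases "x = y")
    case False
    then show ?thesis using 3(2) by (simp add: remdups_adj_Cons[of x] del: filter.simps(2)) (simp add: remdups_adj_Cons[of x])
  qed (use 3(1) in auto)
qed auto

text \<open>A word is recovered from its standardization (which knows the multiplicities) and its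
  condensed form (which knows the letters).\<close>

lemma word_eqI_std_remdups_adj:
  assumes "std h = std h'" "remdups_adj h = remdups_adj h'"
  shows "h = h'"
proof -
  obtain g where g: "strict_mono_on (set h) g" "h' = map g h"
    using std_eq_relabel[OF assms(1)] .
  have "map g (remdups_adj h) = remdups_adj h"
    using assms(2) g remdups_adj_map_inj_on strict_mono_on_imp_inj_on by metis
  \<comment> \<open>Contraction keeps the set of letters, so a relabelling fixing the contraction
    fixes every letter of \<open>h\<close>.\<close>
  then have "\<forall>x\<in>set h. g x = x"
    using map_eq_conv[of g "remdups_adj h" id] by simp
  then show ?thesis using g by (simp add: map_idI)
qed

text \<open>Existence to match the preceding uniqueness: the increasing map from
  \<open>remdups_adj f\<close> to \<open>v\<close> is defined on all letters of \<open>f\<close>, so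
  it can be applied to \<open>f\<close> itself.\<close>

lemma std_remdups_adj_lift:
  assumes "surj_word f" "std v = std (remdups_adj f)" "distinct_adj v"
  obtains h where "std h = f" "remdups_adj h = v"
proof -
  obtain g where g: "strict_mono_on (set f) g" "v = map g (remdups_adj f)"
    using std_eq_relabel[OF assms(2)[symmetric]] by auto
  show ?thesis
  proof
    show "std (map g f) = f" using std_map[OF g(1)] assms(1) by (simp add: std_surj_word)
    show "remdups_adj (map g f) = v"
      using g remdups_adj_map_inj_on strict_mono_on_imp_inj_on by metis
  qed
qed

section \<open>Set compositions as lists of level sets\<close>

text \<open>The index set is an arbitrary \<open>J\<close> so that restricting the blocks by
  \<open>mrestr\<close> gives a list of the same form.\<close>

definition fibres :: "(nat \<Rightarrow> nat) \<Rightarrow> nat set \<Rightarrow> nat set list" where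
  "fibres a J = map (\<lambda>c. {i \<in> J. a i = c}) (sorted_list_of_set (a ` J))"

text \<open>Positions count from 1 while list indices count from 0, whence \<open>i - 1\<close>.
  Only occurring letters are listed, so no block is empty.\<close>

definition pblocks :: "nat list \<Rightarrow> nat set list" where
  "pblocks v = fibres (\<lambda>i. v ! (i - 1)) {1..length v}"

text \<open>Connects lists indexed by a whole range of letters, as in \<open>phi\<close>, with the
  list over the values actually taken.\<close>

lemma filter_nonempty_fibres:
  assumes "sorted ls" "distinct ls" "finite J" "a ` J \<subseteq> set ls"
  shows "filter (\<lambda>b. b \<noteq> {}) (map (\<lambda>c. {i \<in> J. a i = c}) ls) = fibres a J"
proof -
  have "filter (\<lambda>c. c \<in> a ` J) ls = sorted_list_of_set (a ` J)"
    using assms by (intro sorted_distinct_set_unique) (auto simp: sorted_wrt_filter)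
  moreover have "filter (\<lambda>c. {i \<in> J. a i = c} \<noteq> {}) ls = filter (\<lambda>c. c \<in> a ` J) ls"
    by (intro filter_cong) auto
  ultimately show ?thesis
    by (simp add: fibres_def filter_map o_def)
qed

lemma nonempty_fibres: "finite J \<Longrightarrow> b \<in> set (fibres a J) \<Longrightarrow> b \<noteq> {}"
  by (auto simp: fibres_def)

lemma fibres_nth:
  "finite J \<Longrightarrow> c < length (fibres a J) \<Longrightarrow>
    fibres a J ! c = {i \<in> J. a i = sorted_list_of_set (a ` J) ! c}"
  by (simp add: fibres_def)

lemma length_fibres: "length (fibres a J) = card (a ` J)"
  by (simp add: fibres_def)

lemma Union_fibres: "finite J \<Longrightarrow> \<Union>(set (fibres a J)) = J"
  by (auto simp: fibres_def)

lemma fibres_comp: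
  assumes "strict_mono_on (a ` J) g" "finite J" "\<And>i. i \<in> J \<Longrightarrow> a' i = g (a i)"
  shows "fibres a' J = fibres a J"
proof -
  have im: "a' ` J = g ` a ` J" using assms(3) by force
  have "sorted_list_of_set (a' ` J) = map g (sorted_list_of_set (a ` J))"
  proof (rule sorted_distinct_set_unique)
    show "sorted (map g (sorted_list_of_set (a ` J)))"
      unfolding sorted_map
      by (rule sorted_wrt_mono_rel[OF _ sorted_sorted_list_of_set])
        (use assms(1,2) in \<open>auto simp: strict_mono_on_less_eq\<close>)
    show "distinct (map g (sorted_list_of_set (a ` J)))"
      using strict_mono_on_imp_inj_on[OF assms(1)] assms(2) by (simp add: distinct_map)
  qed (use assms(2) im in auto)
  moreover have "{i \<in> J. a' i = g c} = {i \<in> J. a i = c}" if "c \<in> a ` J" for c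
    using that strict_mono_on_eq[OF assms(1)] assms(3) by auto
  ultimately show ?thesis
    using assms(2) by (simp add: fibres_def)
qed

lemma mrestr_fibres:
  assumes "finite J"
  shows "mrestr (fibres a J) I = fibres a (J \<inter> I)"
proof -
  have "map (\<lambda>b. b \<inter> I) (fibres a J) = map (\<lambda>c. {i \<in> J \<inter> I. a i = c}) (sorted_list_of_set (a ` J))"
    by (auto simp: fibres_def)
  then show ?thesis
    unfolding mrestr_def using assms
    by (simp only:) (rule filter_nonempty_fibres, auto)
qed

lemma map_nth_pred: "map (\<lambda>i. v ! (i - 1)) [Suc a..<Suc (length v)] = drop a v"
  by (rule nth_equalityI) (auto simp del: upt_Suc)

lemma image_nth_pred: "(\<lambda>i. v ! (i - 1)) ` {Suc a..length v} = set (drop a v)"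
  using arg_cong[OF map_nth_pred[of v a], of set]
  by (simp only: set_map set_upt atLeastLessThanSuc_atLeastAtMost)

text \<open>The word of block indices in \<open>stdM\<close> is the word of values relabelled by an
  injective map. Such a map commutes with contraction, and undoing it block by block turns indices
  back into values.\<close>

lemma stdM_fibres:
  assumes "finite J"
  shows "stdM (fibres a J) = pblocks (remdups_adj (map a (sorted_list_of_set J)))"
proof -
  define L where "L = sorted_list_of_set (a ` J)"
  define C where "C = fibres a J"
  define idx where "idx s = (THE c. c < length C \<and> s \<in> C ! c)" for s
  define v where "v = remdups_adj (map a (sorted_list_of_set J))"
  have setv: "set v = a ` J" using assms by (simp add: v_def)
  have L: "length L = card (a ` J)" "distinct L" "set L = a ` J"
    using assms by (auto simp: L_def)
  have "\<forall>x\<in>a ` J. \<exists>c. c < length L \<and> L ! c = x"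
    using L(3) by (metis in_set_conv_nth)
  \<comment> \<open>\<open>ix\<close> inverts the enumeration \<open>L\<close> of the values; it
    gives the block index that \<open>stdM\<close> obtains by definite description.\<close>
  then obtain ix where "\<forall>x\<in>a ` J. ix x < length L \<and> L ! ix x = x"
    using bchoice by metis
  then have ix: "ix x < length L" "L ! ix x = x" if "x \<in> a ` J" for x
    using that by auto
  have inj: "inj_on ix (a ` J)" using ix by (metis inj_onI)
  have lenC: "length C = length L" by (simp add: C_def L_def length_fibres)
  have Cnth: "C ! c = {i \<in> J. a i = L ! c}" if "c < length C" for c
    using fibres_nth assms that by (simp add: C_def L_def)
  have idx: "idx s = ix (a s)" if "s \<in> J" for s
    unfolding idx_def
  proof (rule the_equality)
    show "ix (a s) < length C \<and> s \<in> C ! ix (a s)"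
      using ix[of "a s"] that Cnth lenC by auto
    show "c = ix (a s)" if "c < length C \<and> s \<in> C ! c" for c
      using that ix[of "a s"] \<open>s \<in> J\<close> Cnth[of c] lenC L nth_eq_iff_index_eq[of L c "ix (a s)"] by auto
  qed
  have fC: "filter (\<lambda>b. b \<noteq> {}) C = C"
    using nonempty_fibres[OF assms] by (auto simp: C_def)
  have "map idx (sorted_list_of_set J) = map ix (map a (sorted_list_of_set J))"
    using idx assms by simp
  then have w: "remdups_adj (map idx (sorted_list_of_set J)) = map ix v"
    using remdups_adj_map_inj_on[of ix "map a (sorted_list_of_set J)"] inj assms unfolding v_def by (simp only: set_map set_sorted_list_of_set)
  have "stdM C = map (\<lambda>c. {t \<in> {1..length v}. map ix v ! (t - 1) = c}) [0..<length L]"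
    unfolding stdM_def Let_def fC idx_def[symmetric]
    using w Union_fibres[OF assms] lenC by (simp add: C_def)
  also have "\<dots> = map (\<lambda>x. {t \<in> {1..length v}. v ! (t - 1) = x}) L"
  proof (rule nth_equalityI)
    fix c assume "c < length (map (\<lambda>c. {t \<in> {1..length v}. map ix v ! (t - 1) = c}) [0..<length L])"
    then have c: "c < length L" by simp
    have "map ix v ! (t - 1) = c \<longleftrightarrow> v ! (t - 1) = L ! c" if "t \<in> {1..length v}" for t
    proof -
      have t: "t - 1 < length v" using that by auto
      then have "v ! (t - 1) \<in> a ` J" using setv nth_mem by blast
      from ix[OF this] show ?thesis using t c L nth_eq_iff_index_eq[of L c "ix (v ! (t - 1))"] by auto
    qed
    then show "map (\<lambda>c. {t \<in> {1..length v}. map ix v ! (t - 1) = c}) [0..<length L] ! c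
        = map (\<lambda>x. {t \<in> {1..length v}. v ! (t - 1) = x}) L ! c"
      using c by auto
  qed simp
  \<comment> \<open>\<open>L\<close> enumerates exactly the letters of \<open>v\<close>, since
    contraction loses none of them.\<close>
  also have "\<dots> = pblocks v"
    using image_nth_pred[of v 0] setv by (simp add: pblocks_def fibres_def L_def)
  finally show ?thesis by (simp add: C_def v_def)
qed

lemma stdM_filter_nonempty: "stdM (filter (\<lambda>b. b \<noteq> {}) C) = stdM C"
  by (simp add: stdM_def)

text \<open>Common source for \<open>phi\<close>, where \<open>ls\<close> covers all letters, and
  for initial and final segments of a block list, where \<open>ls\<close> is an interval. Reading
  the letters at the selected positions in order gives the filtered word.\<close>

lemma stdM_letter_positions:
  assumes "sorted ls" "distinct ls"
  shows "stdM (map (\<lambda>c. {i \<in> {1..length v}. v ! (i - 1) = c}) ls)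
    = pblocks (remdups_adj (filter (\<lambda>x. x \<in> set ls) v))"
proof -
  let ?a = "\<lambda>i. v ! (i - 1)" let ?J = "{i \<in> {1..length v}. v ! (i - 1) \<in> set ls}"
  have eq: "map (\<lambda>c. {i \<in> {1..length v}. ?a i = c}) ls = map (\<lambda>c. {i \<in> ?J. ?a i = c}) ls"
    by auto
  have "sorted_list_of_set ?J = filter (\<lambda>i. ?a i \<in> set ls) [Suc 0..<Suc (length v)]"
    by (rule sorted_distinct_set_unique) (auto simp: sorted_wrt_filter simp del: upt_Suc)
  then have "map ?a (sorted_list_of_set ?J) = filter (\<lambda>x. x \<in> set ls) (map ?a [Suc 0..<Suc (length v)])"
    by (simp add: filter_map o_def del: upt_Suc)
  then have "map ?a (sorted_list_of_set ?J) = filter (\<lambda>x. x \<in> set ls) v"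
    by (simp only: map_nth_pred drop_0)
  moreover have "stdM (map (\<lambda>c. {i \<in> ?J. ?a i = c}) ls) = stdM (fibres ?a ?J)"
    by (subst stdM_filter_nonempty[symmetric], subst filter_nonempty_fibres) (use assms in auto)
  ultimately show ?thesis
    unfolding eq by (simp add: stdM_fibres)
qed

text \<open>Stated for positive letters, so that it also covers restrictions of surjective words,
  whose letters may have gaps.\<close>

lemma phi_eq_pblocks:
  assumes "0 \<notin> set f"
  shows "phi f = pblocks (remdups_adj f)"
proof -
  have "x \<in> set [1..<wmax f + 1]" if "x \<in> set f" for x
  proof -
    have "x \<le> wmax f" unfolding wmax_def using that by (intro Max_ge) auto
    moreover have "x \<noteq> 0" using that assms by metis
    ultimately show ?thesis by auto
  qed
  then have "filter (\<lambda>x. x \<in> set [1..<wmax f + 1]) f = f"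
    by (simp only: filter_id_conv) blast
  then show ?thesis
    unfolding phi_def using stdM_letter_positions[of "[1..<wmax f + 1]" f]
    by (simp del: upt_Suc)
qed

lemma surj_word_pos: "surj_word f \<Longrightarrow> 0 \<notin> set f"
  by (simp add: surj_word_def)

lemma pblocks_map:
  assumes "strict_mono_on (set v) g"
  shows "pblocks (map g v) = pblocks v"
  unfolding pblocks_def length_map
proof (rule fibres_comp)
  show "strict_mono_on ((\<lambda>i. v ! (i - 1)) ` {1..length v}) g"
    using image_nth_pred[of v 0] assms by simp
qed auto

lemma pblocks_std: "pblocks (std v) = pblocks v"
  by (simp add: std_eq_map_rank pblocks_map strict_mono_on_rank)

lemma pblocks_surj_word:
  assumes "surj_word v"
  shows "pblocks v = map (\<lambda>c. {i \<in> {1..length v}. v ! (i - 1) = c}) [1..<wmax v + 1]"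
proof -
  have "sorted_list_of_set (set v) = [1..<wmax v + 1]"
    using assms unfolding surj_word_def
    by (metis Suc_eq_plus1 atLeastLessThanSuc_atLeastAtMost sorted_list_of_set_range)
  then show ?thesis
    using image_nth_pred[of v 0] by (simp add: pblocks_def fibres_def del: upt_Suc)
qed

text \<open>The union of the blocks gives the length, and each letter is the number of the block
  containing its position.\<close>

lemma pblocks_inject_surj_word:
  assumes "surj_word v" "surj_word w" "pblocks v = pblocks w"
  shows "v = w"
proof (rule nth_equalityI)
  have "{1..length v} = {1..length w}"
    using assms(3) Union_fibres[of "{1..length v}"] Union_fibres[of "{1..length w}"]
    unfolding pblocks_def by (metis finite_atLeastAtMost)
  then show len: "length v = length w"
    by (metis card_atLeastAtMost diff_Suc_1)
  fix i assume i: "i < length v"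
  then have "v ! i \<in> {1..wmax v}" using assms(1) unfolding surj_word_def using nth_mem by blast
  then have c: "v ! i - 1 < length (pblocks v)" "v ! i \<ge> 1"
    using assms(1) by (auto simp: pblocks_surj_word simp del: upt_Suc)
  \<comment> \<open>List index \<open>i\<close> is position \<open>i + 1\<close>, and the letter
    \<open>v ! i\<close> owns the block with list index \<open>v ! i - 1\<close>.\<close>
  then have "i + 1 \<in> pblocks v ! (v ! i - 1)"
    using i assms(1) by (auto simp: pblocks_surj_word simp del: upt_Suc)
  then have "i + 1 \<in> pblocks w ! (v ! i - 1)" "v ! i - 1 < length (pblocks w)"
    using assms(3) c by auto
  then show "v ! i = w ! i"
    using c(2) assms(2) by (auto simp: pblocks_surj_word simp del: upt_Suc)
qed

lemma pblocks_eq_iff: "pblocks v = pblocks w \<longleftrightarrow> std v = std w"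
  by (metis pblocks_std surj_word_std pblocks_inject_surj_word)

lemma mrestr_pblocks_prefix:
  assumes "n \<le> length u"
  shows "mrestr (pblocks u) {1..n} = pblocks (take n u)"
proof -
  have "{1..length u} \<inter> {1..n} = {1..n}" using assms by auto
  then have "mrestr (pblocks u) {1..n} = fibres (\<lambda>i. u ! (i - 1)) {1..n}"
    by (simp only: pblocks_def mrestr_fibres finite_atLeastAtMost)
  also have "\<dots> = pblocks (take n u)"
    unfolding pblocks_def length_take min_absorb2[OF assms]
    \<comment> \<open>The two value functions agree only on \<open>{1..n}\<close>, which
      \<open>fibres_comp\<close> with the identity relabelling accepts.\<close>
    by (rule fibres_comp[where g = id]) (auto simp: strict_mono_on_id)
  finally show ?thesis .
qed

lemma stdM_mrestr_pblocks_suffix: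
  "stdM (mrestr (pblocks u) {a+1..length u}) = pblocks (remdups_adj (drop a u))"
proof -
  have "{1..length u} \<inter> {a+1..length u} = {Suc a..length u}" by auto
  moreover have "map (\<lambda>i. u ! (i - 1)) (sorted_list_of_set {Suc a..length u}) = drop a u"
    unfolding atLeastLessThanSuc_atLeastAtMost[symmetric] sorted_list_of_set_range
    by (rule nth_equalityI) (auto simp del: upt_Suc)
  ultimately show ?thesis
    by (simp add: pblocks_def[of u] mrestr_fibres stdM_fibres)
qed

lemma set_pblocks: "set (pblocks u) = (\<lambda>c. {i \<in> {1..length u}. u ! (i - 1) = c}) ` set u"
  using image_nth_pred[of u 0] by (simp add: pblocks_def fibres_def)

lemma length_pblocks: "length (pblocks u) = card (set u)"
  using image_nth_pred[of u 0] by (simp add: pblocks_def fibres_def)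

lemma pblocks_nth:
  "j < card (set u) \<Longrightarrow>
    pblocks u ! j = {i \<in> {1..length u}. u ! (i - 1) = sorted_list_of_set (set u) ! j}"
  using image_nth_pred[of u 0] by (simp add: pblocks_def fibres_def)

section \<open>\<open>M\<close>-permutations as words without equal neighbours\<close>

text \<open>Level sets are automatically nonempty and disjoint, so only the union and the adjacency
  condition carry information.\<close>

lemma mperm_pblocks_iff: "mperm N (pblocks u) \<longleftrightarrow> length u = N \<and> distinct_adj u"
proof -
  have ne: "\<forall>b\<in>set (pblocks u). b \<noteq> {}"
    by (auto simp: pblocks_def dest: nonempty_fibres[rotated])
  have disj: "pblocks u ! i \<inter> pblocks u ! j = {}"
    if "i < length (pblocks u)" "j < length (pblocks u)" "i \<noteq> j" for i j
    using that nth_eq_iff_index_eq[of "sorted_list_of_set (set u)" i j]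
    by (auto simp: length_pblocks pblocks_nth)
  have "\<Union>(set (pblocks u)) = {1..N} \<longleftrightarrow> length u = N"
    unfolding pblocks_def Union_fibres[OF finite_atLeastAtMost]
    by (auto simp: Icc_eq_Icc)
  moreover have "(\<forall>b\<in>set (pblocks u). \<forall>i. \<not> (i \<in> b \<and> i + 1 \<in> b)) \<longleftrightarrow> distinct_adj u"
  proof
    assume adj: "\<forall>b\<in>set (pblocks u). \<forall>i. \<not> (i \<in> b \<and> i + 1 \<in> b)"
    show "distinct_adj u"
      unfolding distinct_adj_conv_nth
    proof (intro allI impI notI)
      fix i assume i: "Suc i < length u" "u ! i = u ! Suc i"
      \<comment> \<open>The block of a letter repeated at list indices \<open>i\<close> and
        \<open>Suc i\<close> contains the consecutive positions \<open>i + 1\<close> and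
        \<open>i + 2\<close>.\<close>
      let ?b = "{t \<in> {1..length u}. u ! (t - 1) = u ! i}"
      have "?b \<in> set (pblocks u)" using i by (simp add: set_pblocks)
      with adj have "\<not> (i + 1 \<in> ?b \<and> i + 1 + 1 \<in> ?b)" by metis
      then show False using i by auto
    qed
  next
    assume "distinct_adj u"
    note nth = distinct_adj_nth[OF this]
    show "\<forall>b\<in>set (pblocks u). \<forall>i. \<not> (i \<in> b \<and> i + 1 \<in> b)"
    proof (intro ballI allI notI)
      fix b i assume "b \<in> set (pblocks u)" "i \<in> b \<and> i + 1 \<in> b"
      then have "i \<ge> 1" "i + 1 \<le> length u" "u ! (i - 1) = u ! i"
        by (auto simp: set_pblocks)
      then show False using nth[of "i - 1"] by simp
    qed
  qed
  ultimately show ?thesis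
    unfolding mperm_def using ne disj by simp
qed

text \<open>The word records at each position the number of the block containing it; nonemptiness of
  the blocks makes it surjective.\<close>

lemma mperm_imp_pblocks:
  assumes "mperm N W"
  obtains u where "surj_word u" "W = pblocks u"
proof -
  have U: "\<Union>(set W) = {1..N}" and ne: "\<forall>b\<in>set W. b \<noteq> {}"
    and disj: "\<And>i j. i < length W \<Longrightarrow> j < length W \<Longrightarrow> i \<noteq> j \<Longrightarrow> W ! i \<inter> W ! j = {}"
    using assms unfolding mperm_def by auto
  have "\<forall>i\<in>{1..N}. \<exists>j. j < length W \<and> i \<in> W ! j"
    unfolding U[symmetric] by (auto simp: in_set_conv_nth)
  then obtain c where c: "\<forall>i\<in>{1..N}. c i < length W \<and> i \<in> W ! c i"
    using bchoice by metis
  have W: "W ! j = {i \<in> {1..N}. c i = j}" if "j < length W" for j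
  proof -
    have "W ! j \<subseteq> {1..N}" using U that nth_mem by blast
    then show ?thesis using c disj that by blast
  qed
  \<comment> \<open>\<open>Suc\<close> shifts block indices, which start at 0, to letters, which
    start at 1.\<close>
  define u where "u = map (\<lambda>i. Suc (c i)) [1..<Suc N]"
  have len: "length u = N" by (simp add: u_def)
  have nth: "u ! (i - 1) = Suc (c i)" if "i \<in> {1..N}" for i
    using that by (auto simp: u_def simp del: upt_Suc)
  have "c ` {1..N} = {0..<length W}"
  proof
    show "{0..<length W} \<subseteq> c ` {1..N}"
    proof
      fix j assume j: "j \<in> {0..<length W}"
      then have "W ! j \<noteq> {}" using ne by simp
      then show "j \<in> c ` {1..N}" using W[of j] j by auto
    qed
  qed (use c in auto)
  then have "Suc ` c ` {1..N} = {1..length W}"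
    by (simp add: atLeastLessThanSuc_atLeastAtMost)
  then have "set u = {1..length W}"
    by (simp add: u_def image_image atLeastLessThanSuc_atLeastAtMost del: upt_Suc)
  note surj = surj_wordI[OF this]
  have "W = pblocks u"
  proof (rule nth_equalityI)
    show "length W = length (pblocks u)"
      by (simp add: length_pblocks \<open>set u = {1..length W}\<close>)
    fix j assume j: "j < length W"
    then have "pblocks u ! j = {i \<in> {1..N}. u ! (i - 1) = Suc j}"
      using surj len by (simp add: pblocks_surj_word del: upt_Suc)
    also have "\<dots> = W ! j" unfolding W[OF j] using nth by auto
    finally show "W ! j = pblocks u ! j" by simp
  qed
  then show ?thesis using surj(1) that by blast
qed

section \<open>Blocks met by a prefix or a suffix\<close>

lemma positions_meet_prefix:
  assumes "n \<le> length u"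
  shows "{i \<in> {1..length u}. u ! (i - 1) = x} \<inter> {1..n} \<noteq> {} \<longleftrightarrow> x \<in> set (take n u)"
proof -
  have "(\<lambda>i. u ! (i - 1)) ` {Suc 0..n} = (\<lambda>i. take n u ! (i - 1)) ` {Suc 0..n}"
    by (intro image_cong) auto
  also have "\<dots> = set (take n u)"
    using image_nth_pred[of "take n u" 0] assms by simp
  finally show ?thesis using assms by (force simp: image_iff set_eq_iff)
qed

lemma positions_meet_suffix:
  "{i \<in> {1..length u}. u ! (i - 1) = x} \<inter> {a+1..length u} \<noteq> {} \<longleftrightarrow> x \<in> set (drop a u)"
  unfolding image_nth_pred[symmetric] by (force simp: set_eq_iff)

text \<open>Block indices correspond bijectively to letters through the sorted enumeration. The
  prefix and the suffix may overlap.\<close>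

lemma capW_pblocks:
  assumes "n \<le> length u"
  shows "capW (pblocks u) n {a+1..length u} = card (set (take n u) \<inter> set (drop a u))"
proof -
  let ?L = "sorted_list_of_set (set u)" and ?X = "set (take n u) \<inter> set (drop a u)"
  have "{j. j < length (pblocks u) \<and> pblocks u ! j \<inter> {1..n} \<noteq> {} \<and> pblocks u ! j \<inter> {a+1..length u} \<noteq> {}}
      = {j. j < card (set u) \<and> ?L ! j \<in> ?X}" (is "_ = ?S")
    unfolding length_pblocks
    by (intro Collect_cong conj_cong refl)
      (simp only: pblocks_nth positions_meet_prefix[OF assms] positions_meet_suffix Int_iff)
  moreover have "(!) ?L ` ?S = ?X"
  proof
    show "?X \<subseteq> (!) ?L ` ?S"
    proof
      fix x assume x: "x \<in> ?X"
      then have "x \<in> set ?L" using in_set_takeD[of x n u] by simp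
      then obtain j where "j < length ?L" "?L ! j = x" by (metis in_set_conv_nth)
      then show "x \<in> (!) ?L ` ?S" using x by (intro image_eqI[of _ _ j]) auto
    qed
  qed auto
  moreover have "card ((!) ?L ` ?S) = card ?S"
    by (intro card_image inj_on_nth) auto
  ultimately show ?thesis
    unfolding capW_def by (simp only:)
qed

lemma last_pblocks:
  assumes "surj_word u" "u \<noteq> []"
  shows "last (pblocks u) = {i \<in> {1..length u}. u ! (i - 1) = wmax u}"
proof -
  have "wmax u \<noteq> 0" using assms unfolding surj_word_def by (metis atLeastatMost_empty less_one set_empty)
  then show ?thesis
    using assms(1) by (simp add: pblocks_surj_word last_map)
qed

lemma pblocks_remdups_adj_std: "pblocks (remdups_adj (std h)) = pblocks (remdups_adj h)"
  and length_remdups_adj_std: "length (remdups_adj (std h)) = length (remdups_adj h)"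
proof -
  have "remdups_adj (std h) = map (rank (set h)) (remdups_adj h)"
    unfolding std_eq_map_rank
    by (intro remdups_adj_map_inj_on strict_mono_on_imp_inj_on strict_mono_on_rank) simp
  then show "pblocks (remdups_adj (std h)) = pblocks (remdups_adj h)"
    and "length (remdups_adj (std h)) = length (remdups_adj h)"
    by (simp_all add: pblocks_map strict_mono_on_rank)
qed

lemma msize_pblocks: "msize (pblocks v) = length v"
  unfolding msize_def pblocks_def by (simp add: Union_fibres)

section \<open>Contraction of a concatenation\<close>

lemma remdups_adj_append_overlap:
  assumes "h \<noteq> []" "k \<noteq> []" "last h = hd k"
  shows "remdups_adj (h @ k) = remdups_adj h @ tl (remdups_adj k)"
  using assms by (cases k) (auto simp: remdups_adj_append'' tl_remdups_adj)

text \<open>\<open>a\<close> is the offset at which the runs of \<open>k\<close> begin. If the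
  boundary runs merge, the shared run belongs to both parts and the offset drops by one.\<close>

lemma remdups_adj_append_split:
  assumes "h \<noteq> []" "k \<noteq> []"
  defines "u \<equiv> remdups_adj (h @ k)" and "n \<equiv> length (remdups_adj h)"
  defines "a \<equiv> (if last h = hd k then n - 1 else n)"
  shows "take n u = remdups_adj h" "drop a u = remdups_adj k" "length u = a + length (remdups_adj k)"
proof -
  have "take n u = remdups_adj h \<and> drop a u = remdups_adj k \<and> length u = a + length (remdups_adj k)"
  proof (cases "last h = hd k")
    case True
    have u: "u = remdups_adj h @ tl (remdups_adj k)"
      unfolding u_def using assms(1,2) True by (rule remdups_adj_append_overlap)
    \<comment> \<open>The shared run is split off from \<open>h\<close> so that it can be regrouped
      with the remaining runs of \<open>k\<close>.\<close>
    have "remdups_adj h = butlast (remdups_adj h) @ [hd (remdups_adj k)]"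
      using assms(1) True by (metis append_butlast_last_id last_remdups_adj hd_remdups_adj remdups_adj_Nil_iff)
    then have u': "u = butlast (remdups_adj h) @ remdups_adj k"
      using u assms(2) by (metis append.assoc append_Cons append_Nil list.collapse remdups_adj_Nil_iff)
    have "length (butlast (remdups_adj h)) = a" using True by (simp add: a_def n_def)
    then have "drop a u = remdups_adj k" "length u = a + length (remdups_adj k)"
      unfolding u' by simp_all
    moreover have "take n u = remdups_adj h" unfolding u by (simp add: n_def)
    ultimately show ?thesis by simp
  next
    case False
    then show ?thesis
      by (simp add: u_def n_def a_def remdups_adj_append')
  qed
  then show "take n u = remdups_adj h" "drop a u = remdups_adj k" "length u = a + length (remdups_adj k)"
    by auto
qed

text \<open>Converse of the splitting. For \<open>a = n\<close> the boundary letters are neighbours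
  in \<open>u\<close>, hence distinct, and nothing merges; for \<open>a = n - 1\<close> both are the
  letter \<open>u ! (n - 1)\<close> and the runs merge.\<close>

lemma remdups_adj_append_glue:
  assumes u: "distinct_adj u" and n: "1 \<le> n" "n \<le> length u" and a: "a = n \<or> a = n - 1" "a < length u"
    and h: "remdups_adj h = take n u" and k: "remdups_adj k = drop a u"
  shows "remdups_adj (h @ k) = u" "a = (if last h = hd k then n - 1 else n)"
proof -
  have ne: "h \<noteq> []" "k \<noteq> []" using h k n a(2) by auto
  have "last h = last (take n u)" using h last_remdups_adj by metis
  also have "\<dots> = u ! (n - 1)" using n by (subst last_conv_nth) auto
  finally have lh: "last h = u ! (n - 1)" .
  have hk: "hd k = u ! a" using k a(2) hd_remdups_adj by (metis hd_drop_conv_nth)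
  have "remdups_adj (h @ k) = u \<and> a = (if last h = hd k then n - 1 else n)"
  proof (cases "a = n")
    case True
    then have "last h \<noteq> hd k" using lh hk distinct_adj_nth[OF u, of "n - 1"] n a(2) by auto
    then show ?thesis using True h k by (simp add: remdups_adj_append')
  next
    case False
    then have a': "a = n - 1" using a by simp
    then have eq: "last h = hd k" using lh hk by simp
    have "tl (drop a u) = drop (Suc a) u" by (simp only: drop_Suc tl_drop)
    then have "tl (drop a u) = drop n u" using a' n by simp
    then show ?thesis using eq a' remdups_adj_append_overlap[OF ne eq] h k by simp
  qed
  then show "remdups_adj (h @ k) = u" "a = (if last h = hd k then n - 1 else n)" by auto
qed

lemma wmax_in_set: "h \<noteq> [] \<Longrightarrow> 0 \<notin> set h \<Longrightarrow> wmax h \<in> set h"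
  unfolding wmax_def by (simp add: max_def)

lemma wmax_ge: "x \<in> set h \<Longrightarrow> x \<le> wmax h"
  by (simp add: wmax_def)

lemma wmax_append: "wmax (h @ k) = max (wmax h) (wmax k)"
proof -
  have "insert 0 (set (h @ k)) = insert 0 (set h) \<union> insert 0 (set k)" by auto
  moreover have "Max (insert 0 (set h) \<union> insert 0 (set k)) = max (Max (insert 0 (set h))) (Max (insert 0 (set k)))"
    by (rule Max_Un) auto
  ultimately show ?thesis unfolding wmax_def by (simp only:)
qed

text \<open>With \<open>m\<close> the maximum of the other factor, this decides whether the largest
  letter of the concatenation occurs in \<open>h\<close>, the condition that separates the three
  products.\<close>

lemma max_wmax_in_set_iff:
  assumes "h \<noteq> []" "0 \<notin> set h"
  shows "max (wmax h) m \<in> set h \<longleftrightarrow> m \<le> wmax h"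
  using wmax_in_set[OF assms] wmax_ge[of "max (wmax h) m" h] by (auto simp: max_def)

text \<open>Dictionary between a pair \<open>(h, k)\<close> and a term \<open>W\<close> with
  interval \<open>{a+1..a+m}\<close>. The prefix and the suffix of the contraction have the letters
  of \<open>h\<close> and \<open>k\<close>, and the last block belongs to the largest
  letter.\<close>

lemma pblocks_remdups_adj_append:
  assumes ne: "h \<noteq> []" "k \<noteq> []" and surj: "surj_word (h @ k)"
  defines "W \<equiv> pblocks (remdups_adj (h @ k))"
    and "n \<equiv> length (remdups_adj h)" and "m \<equiv> length (remdups_adj k)"
  defines "a \<equiv> (if last h = hd k then n - 1 else n)"
  shows "mperm (a + m) W"
    and "mrestr W {1..n} = pblocks (remdups_adj h)"
    and "stdM (mrestr W {a+1..a+m}) = pblocks (remdups_adj k)"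
    and "capW W n {a+1..a+m} = cap h k"
    and "last W \<inter> {1..n} \<noteq> {} \<longleftrightarrow> wmax k \<le> wmax h"
    and "last W \<inter> {a+1..a+m} \<noteq> {} \<longleftrightarrow> wmax h \<le> wmax k"
proof -
  define u where "u = remdups_adj (h @ k)"
  note split = remdups_adj_append_split[OF ne, folded u_def n_def, folded a_def m_def]
  have W: "W = pblocks u" by (simp add: W_def u_def)
  have n: "n \<le> length u" using split(1) by (metis linorder_linear n_def take_all)
  have len: "a + m = length u" using split(3) by simp
  have setu: "set u = set (h @ k)" by (simp add: u_def)
  have u: "surj_word u" "wmax u = max (wmax h) (wmax k)" "u \<noteq> []"
    using surj_word_eqI[OF setu] surj wmax_eqI[OF setu] ne by (auto simp: wmax_append u_def)
  have pos: "0 \<notin> set h" "0 \<notin> set k" using surj_word_pos[OF surj] by auto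
  have sets: "set (take n u) = set h" "set (drop a u) = set k"
    using split by simp_all
  show "mperm (a + m) W" unfolding W mperm_pblocks_iff using len by (simp add: u_def)
  show "mrestr W {1..n} = pblocks (remdups_adj h)"
    unfolding W using mrestr_pblocks_prefix[OF n] split by simp
  show "stdM (mrestr W {a+1..a+m}) = pblocks (remdups_adj k)"
    unfolding W len stdM_mrestr_pblocks_suffix split(2)
    \<comment> \<open>The suffix is already contracted, so contracting it again changes
      nothing.\<close>
    by (simp only: distinct_adj_remdups_adj[unfolded distinct_adj_altdef])
  show "capW W n {a+1..a+m} = cap h k"
    unfolding W len capW_pblocks[OF n] cap_def sets ..
  show "last W \<inter> {1..n} \<noteq> {} \<longleftrightarrow> wmax k \<le> wmax h"
    unfolding W last_pblocks[OF u(1,3)] positions_meet_prefix[OF n] sets u(2)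
    using ne pos by (simp add: max_wmax_in_set_iff)
  show "last W \<inter> {a+1..a+m} \<noteq> {} \<longleftrightarrow> wmax h \<le> wmax k"
    unfolding W len last_pblocks[OF u(1,3)] positions_meet_suffix sets u(2)
    using max_wmax_in_set_iff[OF ne(2) pos(2), of "wmax h"] by (simp only: max.commute)
qed

section \<open>Linear extension of maps between bases\<close>

text \<open>Cancellation can make the support smaller than the image of \<open>\<pi>\<close>, but
  the added summands are zero. Over the finite image the terms can be regrouped.\<close>

lemma lin_pushforward:
  assumes "finite A"
  shows "lin F (\<lambda>w. \<Sum>p\<in>{p \<in> A. \<pi> p = w}. v p) y = (\<Sum>p\<in>{p \<in> A. F (\<pi> p) = y}. v p)"
proof -
  let ?c = "\<lambda>w. \<Sum>p\<in>{p \<in> A. \<pi> p = w}. v p"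
  have supp: "w \<in> \<pi> ` A" if "?c w \<noteq> 0" for w
  proof (rule ccontr)
    assume "w \<notin> \<pi> ` A"
    then have "{p \<in> A. \<pi> p = w} = {}" by auto
    then have "?c w = 0" by (simp only: sum.empty)
    then show False using that by contradiction
  qed
  have "lin F ?c y = sum ?c {x. ?c x \<noteq> 0 \<and> F x = y}"
    by (simp only: lin_def)
  also have "\<dots> = sum ?c {x \<in> \<pi> ` A. F x = y}"
  proof (rule sum.mono_neutral_left)
    show "finite {x \<in> \<pi> ` A. F x = y}" using assms by simp
    show "{x. ?c x \<noteq> 0 \<and> F x = y} \<subseteq> {x \<in> \<pi> ` A. F x = y}" using supp by blast
    show "\<forall>x\<in>{x \<in> \<pi> ` A. F x = y} - {x. ?c x \<noteq> 0 \<and> F x = y}. ?c x = 0" by blast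
  qed
  also have "\<dots> = (\<Sum>x\<in>{x \<in> \<pi> ` A. F x = y}. \<Sum>p\<in>{p \<in> {p \<in> A. F (\<pi> p) = y}. \<pi> p = x}. v p)"
    by (intro sum.cong) (auto intro!: sum.cong)
  also have "\<dots> = (\<Sum>p\<in>{p \<in> A. F (\<pi> p) = y}. v p)"
    by (rule sum.group) (use assms in auto)
  finally show ?thesis .
qed

lemma sum_fun_apply: "(\<Sum>j\<in>J. f j) x = (\<Sum>j\<in>J. f j x)"
  by (induction J rule: infinite_finite_induct) (auto simp: zero_fun_def plus_fun_def)

text \<open>Brings a sum of basis vectors, repetitions included, into the shape required by
  \<open>lin_pushforward\<close>.\<close>

lemma sum_vec:
  assumes "finite J"
  shows "(\<Sum>j\<in>J. vec (x j)) = (\<lambda>w. \<Sum>j\<in>{j \<in> J. x j = w}. 1 :: 'a::field)"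
proof
  fix w
  have "(\<Sum>j\<in>J. vec (x j)) w = (\<Sum>j\<in>J. if x j = w then 1 else 0 :: 'a)"
    unfolding sum_fun_apply by (intro sum.cong) (auto simp: vec_def)
  also have "\<dots> = (\<Sum>j\<in>{j \<in> J. x j = w}. 1)"
    using assms by (simp only: sum.inter_filter)
  finally show "(\<Sum>j\<in>J. vec (x j)) w = (\<Sum>j\<in>{j \<in> J. x j = w}. 1 :: 'a)" .
qed

lemma lin_sum_vec:
  assumes "finite J"
  shows "lin F (\<Sum>j\<in>J. vec (x j)) = (\<Sum>j\<in>J. vec (F (x j)) :: _ \<Rightarrow> 'a::field)"
  unfolding sum_vec[OF assms] by (rule ext) (rule lin_pushforward[OF assms])

section \<open>Comparison of the products\<close>

lemma set_surj_word_subset: "surj_word w \<Longrightarrow> set w \<subseteq> {1..length w}"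
  using card_length[of w] unfolding surj_word_def by (metis atLeastatMost_subset_iff card_atLeastAtMost diff_Suc_1 order_refl)

text \<open>The lengths of \<open>h\<close> and \<open>k\<close> are fixed by \<open>f\<close> and
  \<open>g\<close>, and surjectivity bounds the letters by the total length.\<close>

lemma finite_std_factorizations:
  "finite {(h, k). surj_word (h @ k) \<and> std h = f \<and> std k = g}" (is "finite ?A")
proof (rule finite_subset)
  let ?X = "\<lambda>l. {h. set h \<subseteq> {1..length f + length g} \<and> length h = l}"
  show "?A \<subseteq> ?X (length f) \<times> ?X (length g)"
    using set_surj_word_subset by fastforce
  show "finite (?X (length f) \<times> ?X (length g))"
    by (intro finite_cartesian_product finite_lists_length_eq) auto
qed

lemma lin_st_prod:
  "lin F (st_prod R E q f g) W =
    (\<Sum>(h, k)\<in>{(h, k). F (h @ k) = W \<and> surj_word (h @ k) \<and> std h = f \<and> std k = g \<and> R (wmax h) (wmax k)}.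
      q ^ E (cap h k))"
proof -
  let ?A = "{(h, k). surj_word (h @ k) \<and> std h = f \<and> std k = g \<and> R (wmax h) (wmax k)}"
  have fin: "finite ?A"
    by (rule finite_subset[OF _ finite_std_factorizations[of f g]]) auto
  have "st_prod R E q f g = (\<lambda>w. \<Sum>p\<in>{p \<in> ?A. case_prod (@) p = w}. case p of (h, k) \<Rightarrow> q ^ E (cap h k))"
    unfolding st_prod_def by (intro ext sum.cong) auto
  then have "lin F (st_prod R E q f g) W =
      (\<Sum>p\<in>{p \<in> ?A. F (case_prod (@) p) = W}. case p of (h, k) \<Rightarrow> q ^ E (cap h k))"
    using lin_pushforward[OF fin] by simp
  also have "\<dots> = (\<Sum>(h, k)\<in>{(h, k). F (h @ k) = W \<and> surj_word (h @ k) \<and> std h = f \<and> std k = g \<and> R (wmax h) (wmax k)}.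
      q ^ E (cap h k))"
    by (intro sum.cong) auto
  finally show ?thesis .
qed

text \<open>Describing \<open>S\<close> by its offset \<open>a\<close> unites the two kinds of
  terms, as \<open>W\<close> has size \<open>a + m\<close> in both. Here \<open>m \<ge> 1\<close>
  makes different offsets give different \<open>S\<close>, and \<open>n \<ge> 1\<close> makes
  \<open>n - 1\<close> a true predecessor.\<close>

lemma mmr_prod_shift:
  assumes "msize B = n" "msize D = m" "n \<ge> 1" "m \<ge> 1"
  shows "mmr_prod P E q B D W =
    (\<Sum>a\<in>{a. (a = n \<or> a = n - 1) \<and> mperm (a + m) W \<and> mrestr W {1..n} = B
          \<and> stdM (mrestr W {a+1..a+m}) = D \<and> P (last W) {1..n} {a+1..a+m}}.
      q ^ E (capW W n {a+1..a+m}))" (is "_ = sum _ ?T")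
proof -
  let ?S = "\<lambda>a. {a+1..a+m}"
  have inj: "inj_on ?S ?T"
  proof (rule inj_onI)
    fix a b assume "?S a = ?S b"
    then show "a = b" using assms(4) by (simp add: Icc_eq_Icc)
  qed
  have pred: "{n..n+m-1} = ?S (n - 1)" "n + m - 1 = n - 1 + m" using assms(3) by auto
  have "{S. ((mperm (n + m) W \<and> S = {n+1..n+m}) \<or> (mperm (n + m - 1) W \<and> S = {n..n+m-1}))
              \<and> mrestr W {1..n} = B \<and> stdM (mrestr W S) = D \<and> P (last W) {1..n} S} = ?S ` ?T"
    unfolding pred(1) unfolding pred(2) by blast
  then show ?thesis
    unfolding mmr_prod_def Let_def assms(1,2) by (simp only: sum.reindex[OF inj] o_def)
qed

text \<open>For fixed \<open>W\<close>, the pairs \<open>(h, k)\<close> contributing to its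
  coefficient correspond bijectively to the admissible offsets, with equal weights. The assumption
  on \<open>P\<close> and \<open>R\<close> lets one argument serve all three products.\<close>

lemma phi_st_prod:
  fixes q :: "'a::field"
  assumes f: "surj_word f" "f \<noteq> []" and g: "surj_word g" "g \<noteq> []"
    and PR: "\<And>L N S x y. (L \<inter> N \<noteq> {} \<longleftrightarrow> y \<le> x) \<Longrightarrow> (L \<inter> S \<noteq> {} \<longleftrightarrow> x \<le> y) \<Longrightarrow> P L N S \<longleftrightarrow> R x y"
  shows "lin phi (st_prod R E q f g) = mmr_prod P E q (phi f) (phi g)"
proof
  fix W
  define n m where "n = length (remdups_adj f)" and "m = length (remdups_adj g)"
  have nm: "n \<ge> 1" "m \<ge> 1" using f g by (simp_all add: n_def m_def)
  have phi: "phi f = pblocks (remdups_adj f)" "phi g = pblocks (remdups_adj g)"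
    using f g by (simp_all add: phi_eq_pblocks surj_word_pos)
  let ?A = "{(h, k). phi (h @ k) = W \<and> surj_word (h @ k) \<and> std h = f \<and> std k = g \<and> R (wmax h) (wmax k)}"
  let ?T = "{a. (a = n \<or> a = n - 1) \<and> mperm (a + m) W \<and> mrestr W {1..n} = phi f
      \<and> stdM (mrestr W {a+1..a+m}) = phi g \<and> P (last W) {1..n} {a+1..a+m}}"
  define \<tau> where "\<tau> = (\<lambda>(h :: nat list, k :: nat list). if last h = hd k then n - 1 else n)"
  \<comment> \<open>Standardization changes neither the number of runs nor the blocks, so the data
    of \<open>f\<close> and \<open>g\<close> can be read off from \<open>h\<close> and
    \<open>k\<close>.\<close>
  have data: "h \<noteq> []" "k \<noteq> []" "n = length (remdups_adj h)" "m = length (remdups_adj k)"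
      "phi f = pblocks (remdups_adj h)" "phi g = pblocks (remdups_adj k)"
    if "std h = f" "std k = g" for h k :: "nat list"
  proof -
    show "h \<noteq> []" using f(2) that(1) by (auto simp: std_eq_map_rank)
    show "k \<noteq> []" using g(2) that(2) by (auto simp: std_eq_map_rank)
    show "n = length (remdups_adj h)" "m = length (remdups_adj k)"
      using that length_remdups_adj_std by (auto simp: n_def m_def)
    show "phi f = pblocks (remdups_adj h)" "phi g = pblocks (remdups_adj k)"
      using that pblocks_remdups_adj_std by (auto simp: phi)
  qed
  have W: "W = pblocks (remdups_adj (h @ k))" if "phi (h @ k) = W" "surj_word (h @ k)" for h k
    using that phi_eq_pblocks surj_word_pos by metis
  have terms: "\<tau> (h, k) \<in> ?T \<and> capW W n {\<tau> (h, k) + 1..\<tau> (h, k) + m} = cap h k"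
    if "(h, k) \<in> ?A" for h k
  proof -
    have hk: "phi (h @ k) = W" "surj_word (h @ k)" "std h = f" "std k = g" "R (wmax h) (wmax k)"
      using that by auto
    note d = data[OF hk(3,4)]
    have \<tau>: "\<tau> (h, k) = (if last h = hd k then n - 1 else n)" by (simp add: \<tau>_def)
    note b = pblocks_remdups_adj_append[OF d(1,2) hk(2), folded d(3,4,5,6) W[OF hk(1,2)], folded \<tau>]
    show ?thesis using b(1-4) PR[OF b(5,6)] hk(5) \<tau> by auto
  qed
  have "bij_betw \<tau> ?A ?T"
    unfolding bij_betw_def
  proof
    show "inj_on \<tau> ?A"
    proof (rule inj_onI)
      fix p p' assume pA: "p \<in> ?A" "p' \<in> ?A" and eq: "\<tau> p = \<tau> p'"
      obtain h k h' k' where p: "p = (h, k)" "p' = (h', k')" by fastforce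
      have hk: "phi (h @ k) = W" "surj_word (h @ k)" "std h = f" "std k = g"
        and hk': "phi (h' @ k') = W" "surj_word (h' @ k')" "std h' = f" "std k' = g"
        using pA p by auto
      note d = data[OF hk(3,4)] and d' = data[OF hk'(3,4)]
      \<comment> \<open>Both contractions are surjective words with block list \<open>W\<close>.
        Together with the offset they determine the contractions of the factors, and these with
        \<open>f\<close> and \<open>g\<close> determine the factors.\<close>
      have u: "remdups_adj (h @ k) = remdups_adj (h' @ k')"
        using W[OF hk(1,2)] W[OF hk'(1,2)] hk(2) hk'(2)
        by (intro pblocks_inject_surj_word) (simp_all add: surj_word_eqI[OF remdups_adj_set])
      have \<tau>: "\<tau> (h, k) = (if last h = hd k then n - 1 else n)"
        "\<tau> (h', k') = (if last h' = hd k' then n - 1 else n)" by (simp_all add: \<tau>_def)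
      note s = remdups_adj_append_split[OF d(1,2), folded d(3), folded \<tau>(1)]
      note s' = remdups_adj_append_split[OF d'(1,2), folded d'(3), folded \<tau>(2)]
      have "remdups_adj h = remdups_adj h'" using s(1) s'(1) unfolding u by (rule trans[OF sym])
      moreover have "remdups_adj k = remdups_adj k'"
        using s(2) s'(2) unfolding u eq[unfolded p] by (rule trans[OF sym])
      ultimately have "h = h'" "k = k'"
        using hk(3,4) hk'(3,4) by (simp_all add: word_eqI_std_remdups_adj)
      then show "p = p'" by (simp add: p)
    qed
    show "\<tau> ` ?A = ?T"
    proof
      show "\<tau> ` ?A \<subseteq> ?T" using terms by auto
      show "?T \<subseteq> \<tau> ` ?A"
      proof
        fix a assume "a \<in> ?T"
        then have a: "a = n \<or> a = n - 1" "mperm (a + m) W" "mrestr W {1..n} = phi f"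
          "stdM (mrestr W {a+1..a+m}) = phi g" "P (last W) {1..n} {a+1..a+m}" by auto
        \<comment> \<open>For surjectivity, the word of \<open>W\<close> is cut at \<open>n\<close>
          and at \<open>a\<close>, and both pieces are lifted to words standardizing to
          \<open>f\<close> and \<open>g\<close>.\<close>
        obtain u where u: "surj_word u" "W = pblocks u" using mperm_imp_pblocks[OF a(2)] .
        have len: "length u = a + m" "distinct_adj u"
          using a(2) unfolding u(2) mperm_pblocks_iff by auto
        have le: "n \<le> length u" "a < length u" using a(1) nm len by auto
        have "pblocks (take n u) = pblocks (remdups_adj f)"
          using a(3) unfolding u(2) mrestr_pblocks_prefix[OF le(1)] phi .
        moreover have "distinct_adj (take n u)" "distinct_adj (drop a u)"
          using len(2) by (metis append_take_drop_id distinct_adj_appendD1 distinct_adj_appendD2)+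
        ultimately obtain h where h: "std h = f" "remdups_adj h = take n u"
          using std_remdups_adj_lift[OF f(1), of "take n u"] unfolding pblocks_eq_iff by auto
        have "remdups_adj (drop a u) = drop a u"
          using \<open>distinct_adj (drop a u)\<close> by (simp add: distinct_adj_altdef)
        then have "pblocks (drop a u) = pblocks (remdups_adj g)"
          using a(4) unfolding u(2) phi len(1)[symmetric] stdM_mrestr_pblocks_suffix by simp
        then obtain k where k: "std k = g" "remdups_adj k = drop a u"
          using std_remdups_adj_lift[OF g(1), of "drop a u"] \<open>distinct_adj (drop a u)\<close>
          unfolding pblocks_eq_iff by auto
        note glue = remdups_adj_append_glue[OF len(2) nm(1) le(1) a(1) le(2) h(2) k(2)]
        have surj: "surj_word (h @ k)"
          using u(1) glue(1) surj_word_eqI remdups_adj_set by metis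
        then have phiW: "phi (h @ k) = W"
          using u(2) glue(1) phi_eq_pblocks surj_word_pos by metis
        note d = data[OF h(1) k(1)]
        note b = pblocks_remdups_adj_append[OF d(1,2) surj, folded d(3,4,5,6) W[OF phiW surj], folded glue(2)]
        have "(h, k) \<in> ?A"
          using phiW surj h(1) k(1) PR[OF b(5,6)] a(5) by auto
        moreover have "\<tau> (h, k) = a" using glue(2) by (simp add: \<tau>_def)
        ultimately show "a \<in> \<tau> ` ?A" by blast
      qed
    qed
  qed
  then have "(\<Sum>a\<in>?T. q ^ E (capW W n {a+1..a+m}))
      = (\<Sum>p\<in>?A. q ^ E (capW W n {\<tau> p + 1..\<tau> p + m}))"
    by (rule sum.reindex_bij_betw[symmetric])
  also have "\<dots> = (\<Sum>(h, k)\<in>?A. q ^ E (cap h k))"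
    using terms by (intro sum.cong) auto
  finally show "lin phi (st_prod R E q f g) W = mmr_prod P E q (phi f) (phi g) W"
    unfolding lin_st_prod
    using mmr_prod_shift[of "phi f" n "phi g" m P E q W] nm by (simp add: phi msize_pblocks n_def m_def)
qed

section \<open>Comparison of the coproducts\<close>

text \<open>In a surjective word the block order is the order of the letters
  \<open>1, 2, ...\<close>, so cutting the block list amounts to restricting the word to an interval
  of letters.\<close>

lemma stdM_take_pblocks:
  assumes "surj_word u" "j \<le> wmax u"
  shows "stdM (take j (pblocks u)) = pblocks (remdups_adj (wrestr u {1..j}))"
proof -
  have "take j [1..<wmax u + 1] = [1..<j + 1]"
    using assms(2) by (simp add: take_upt del: upt_Suc)
  moreover have "set [1..<j + 1] = {1..j}" by auto
  ultimately show ?thesis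
    using stdM_letter_positions[of "[1..<j + 1]" u]
    by (simp add: pblocks_surj_word[OF assms(1)] take_map wrestr_def del: upt_Suc)
qed

lemma stdM_drop_pblocks:
  assumes "surj_word u"
  shows "stdM (drop j (pblocks u)) = pblocks (remdups_adj (wrestr u {j+1..wmax u}))"
proof -
  have "drop j [1..<wmax u + 1] = [j + 1..<wmax u + 1]"
    by (simp add: drop_upt del: upt_Suc)
  moreover have "set [j + 1..<wmax u + 1] = {j+1..wmax u}" by auto
  ultimately show ?thesis
    using stdM_letter_positions[of "[j + 1..<wmax u + 1]" u]
    by (simp add: pblocks_surj_word[OF assms(1)] drop_map wrestr_def del: upt_Suc)
qed

text \<open>Contraction keeps the maximal letter, so both sums run over the same cuts. Terms agree
  because contraction is compatible with restriction and \<open>phi\<close> does not see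
  standardization.\<close>

lemma phi_coprod:
  assumes "surj_word f"
  shows "(mmr_coprod (phi f) :: _ \<Rightarrow> 'a::field) = lin (map_prod phi phi) (st_coprod f)"
proof -
  define u where "u = remdups_adj f"
  have u: "surj_word u" "wmax u = wmax f"
    using assms surj_word_eqI[of u f] wmax_eqI[of u f] by (auto simp: u_def)
  have phi: "phi f = pblocks u"
    using assms by (simp add: phi_eq_pblocks surj_word_pos u_def)
  have len: "length (phi f) = wmax f"
    unfolding phi using u by (simp add: pblocks_surj_word)
  have restr: "pblocks (remdups_adj (wrestr u K)) = phi (wrestr f K)" for K
  proof -
    have "0 \<notin> set (wrestr f K)" using surj_word_pos[OF assms] by (simp add: wrestr_def)
    then show ?thesis
      by (simp add: phi_eq_pblocks) (simp add: u_def wrestr_def remdups_adj_filter_remdups_adj)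
  qed
  have phi_std: "phi (std (wrestr f K)) = phi (wrestr f K)" for K
  proof -
    have "0 \<notin> set (wrestr f K)" using surj_word_pos[OF assms] by (simp add: wrestr_def)
    then show ?thesis
      by (simp add: phi_eq_pblocks surj_word_pos surj_word_std pblocks_remdups_adj_std)
  qed
  have "(mmr_coprod (phi f) :: _ \<Rightarrow> 'a) =
      (\<Sum>j\<in>{0..wmax f}. vec (phi (wrestr f {1..j}), phi (std (wrestr f {j+1..wmax f}))))"
    unfolding mmr_coprod_def len
    by (rule sum.cong) (use u stdM_take_pblocks[OF u(1)] stdM_drop_pblocks[OF u(1)] in
        \<open>simp_all add: phi phi_std flip: restr\<close>)
  also have "\<dots> = lin (map_prod phi phi) (st_coprod f)"
    unfolding st_coprod_def by (simp add: lin_sum_vec)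
  finally show ?thesis .
qed

theorem theorem3p4:
  fixes q :: "'a::field"
  shows "phi [] = [] \<and>
    (\<forall>n B. n \<ge> 1 \<and> mperm n B \<longrightarrow> (\<exists>k f. k \<ge> 1 \<and> f \<in> STn k \<and> phi f = B)) \<and>
    (\<forall>n m f g. n \<ge> 1 \<and> m \<ge> 1 \<and> f \<in> STn n \<and> g \<in> STn m \<longrightarrow>
           lin phi (st_prec q f g) = mmr_prec q (phi f) (phi g)
         \<and> lin phi (st_dot q f g) = mmr_dot q (phi f) (phi g)
         \<and> lin phi (st_succ q f g) = mmr_succ q (phi f) (phi g)
         \<and> (mmr_coprod (phi f) :: _ \<Rightarrow> 'a) = lin (map_prod phi phi) (st_coprod f))"
proof (intro conjI allI impI)
  show "phi [] = []"
    by (simp add: phi_eq_pblocks pblocks_def fibres_def)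
next
  fix n B assume B: "n \<ge> 1 \<and> mperm n B"
  then obtain u where u: "surj_word u" "B = pblocks u"
    using mperm_imp_pblocks by blast
  \<comment> \<open>The word of an \<open>M\<close>-permutation is its own contraction, so it serves
    as a preimage.\<close>
  then have "length u = n" "remdups_adj u = u"
    using B mperm_pblocks_iff by (auto simp: distinct_adj_altdef)
  then show "\<exists>k f. k \<ge> 1 \<and> f \<in> STn k \<and> phi f = B"
    using u B by (intro exI[of _ n] exI[of _ u]) (simp add: STn_def phi_eq_pblocks surj_word_pos)
next
  fix n m f g assume "n \<ge> 1 \<and> m \<ge> 1 \<and> f \<in> STn n \<and> g \<in> STn m"
  then have f: "surj_word f" "f \<noteq> []" and g: "surj_word g" "g \<noteq> []"
    by (auto simp: STn_def)
  show "lin phi (st_prec q f g) = mmr_prec q (phi f) (phi g)"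
    \<comment> \<open>What remains for \<open>auto\<close> is to match the last-block condition with
      the comparison of maxima: \<open>L \<inter> S = {}\<close> is the negation of
      \<open>x \<le> y\<close>.\<close>
    unfolding st_prec_def mmr_prec_def by (rule phi_st_prod[OF f g]) auto
  show "lin phi (st_dot q f g) = mmr_dot q (phi f) (phi g)"
    unfolding st_dot_def mmr_dot_def by (rule phi_st_prod[OF f g]) auto
  show "lin phi (st_succ q f g) = mmr_succ q (phi f) (phi g)"
    unfolding st_succ_def mmr_succ_def by (rule phi_st_prod[OF f g]) auto
  show "(mmr_coprod (phi f) :: _ \<Rightarrow> 'a) = lin (map_prod phi phi) (st_coprod f)"
    using f(1) by (rule phi_coprod)
qed

end
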